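(* Let $n\ge 1$ and let $L:\mathbb{R}[\underline{x}]\to\mathbb{R}$ be a PSD linear map such that for each $j=1,\dots,n$ there exists a sequence $\{q_{jk}\}_{k=1}^{\infty}$ in $\mathbb{C}[\underline{x}]$ with $$\lim_{k\to\infty} L\big(|1-(1+x_j^2)q_{jk}\overline{q_{jk}}|^2\big)=0.$$ Let $\mu$ be the associated positive Borel measure on $\mathbb{R}^n$, i.e. the positive Borel measure with finite moments such that $L=L_\mu$. Let $g\in\mathbb{R}[\underline{x}]$ be such that $L(gh^2)\ge 0$ for all $h\in\mathbb{R}[\underline{x}]$. Then the support of $\mu$ is contained in the set $\{\underline{a}\in\mathbb{R}^n \mid g(\underline{a})\ge 0\}$.
   Context: Notation: $\mathbb{R}[\underline{x}]:=\mathbb{R}[x_1,\dots,x_n]$ and $\mathbb{C}[\underline{x}]:=\mathbb{C}[x_1,\dots,x_n]$. For $f=f_1+if_2\in\mathbb{C}[\underline{x}]$ with $f_1,f_2\in\mathbb{R}[\underline{x}]$, $\overline{f}:=f_1-if_2$ and $|f|^2:=f\overline{f}=f_1^2+f_2^2\in\mathbb{R}[\underline{x}]$. A linear map $L:\mathbb{R}[\underline{x}]\to\mathbb{R}$ is PSD (positive semidefinite) if $L(f^2)\ge 0$ for all $f\in\mathbb{R}[\underline{x}]$. If $\mu$ is a positive Borel measure on $\mathbb{R}^n$ having finite moments (i.e. $\int x_1^{k_1}\cdots x_n^{k_n}\,d\mu$ is well-defined and finite for all integers $k_1,\dots,k_n\ge 0$), then $L_\mu:\mathbb{R}[\underline{x}]\to\mathbb{R}$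 is the linear map $L_\mu(f):=\int f\,d\mu$. Under the stated limit condition for all $j=1,\dots,n$, a positive Borel measure $\mu$ on $\mathbb{R}^n$ with $L=L_\mu$ exists and is unique; this is the associated measure. The support of $\mu$ is the smallest closed set $K\subseteq\mathbb{R}^n$ satisfying $\mu(\mathbb{R}^n\setminus K)=0$. *)

theory Defs
  imports "HOL-Analysis.Analysis" "HOL-Analysis.Finite_Function_Topology"
begin

text \<open>Polynomials with coefficients in \<open>'a\<close> in the variables indexed by \<open>'n\<close>: finitely supported
  maps from exponent vectors to coefficients. Ring operations are those of
  \<^theory>\<open>HOL-Library.Poly_Mapping\<close>, the real vector space structure that of
  \<^theory>\<open>HOL-Analysis.Finite_Function_Topology\<close>.\<close>

type_synonym ('n, 'a) mvpoly = "('n \<Rightarrow>\<^sub>0 nat) \<Rightarrow>\<^sub>0 'a"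

definition pvar :: "'n \<Rightarrow> ('n, 'a::comm_ring_1) mvpoly"
  where "pvar j = Poly_Mapping.single (Poly_Mapping.single j 1) 1"

definition monom_eval :: "('n::finite \<Rightarrow> nat) \<Rightarrow> real ^ 'n \<Rightarrow> real"
  where "monom_eval k a = (\<Prod>j\<in>UNIV. (a $ j) ^ k j)"

definition peval :: "('n::finite, real) mvpoly \<Rightarrow> real ^ 'n \<Rightarrow> real"
  where "peval p a =
    (\<Sum>m\<in>Poly_Mapping.keys p. Poly_Mapping.lookup p m * monom_eval (Poly_Mapping.lookup m) a)"

text \<open>Coefficientwise real and imaginary part: \<open>f = f\<^sub>1 + i f\<^sub>2\<close> with \<open>f\<^sub>1, f\<^sub>2\<close> real.\<close>

definition pRe :: "('n, complex) mvpoly \<Rightarrow> ('n, real) mvpoly"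
  where "pRe f = Poly_Mapping.map Re f"

definition pIm :: "('n, complex) mvpoly \<Rightarrow> ('n, real) mvpoly"
  where "pIm f = Poly_Mapping.map Im f"

definition complexify :: "('n, real) mvpoly \<Rightarrow> ('n, complex) mvpoly"
  where "complexify f = Poly_Mapping.map complex_of_real f"

definition pconj :: "('n, complex) mvpoly \<Rightarrow> ('n, complex) mvpoly"
  where "pconj f = complexify (pRe f) - Poly_Mapping.single 0 \<i> * complexify (pIm f)"

text \<open>\<open>|f|\<^sup>2\<close> as an element of the real polynomial ring; lemma \<open>complexify_pabs2\<close> below shows that
  it is \<open>f\<close> times its conjugate.\<close>

definition pabs2 :: "('n, complex) mvpoly \<Rightarrow> ('n, real) mvpoly"
  where "pabs2 f = (pRe f)\<^sup>2 + (pIm f)\<^sup>2"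

definition psd :: "(('n, real) mvpoly \<Rightarrow> real) \<Rightarrow> bool"
  where "psd L \<longleftrightarrow> linear L \<and> (\<forall>f. L (f\<^sup>2) \<ge> 0)"

definition borel_measure_with_moments :: "(real ^ 'n::finite) measure \<Rightarrow> bool"
  where "borel_measure_with_moments M \<longleftrightarrow>
    sets M = sets borel \<and> (\<forall>k. integrable M (monom_eval k))"

definition moment_functional :: "(real ^ 'n::finite) measure \<Rightarrow> ('n, real) mvpoly \<Rightarrow> real"
  where "moment_functional M f = (\<integral>x. peval f x \<partial>M)"

text \<open>The smallest closed set of full measure; see \<open>closed_msupport\<close>, \<open>null_msupport\<close> and
  \<open>msupport_least\<close>.\<close>

definition msupport :: "'a::second_countable_topology measure \<Rightarrow> 'a set"
  where "msupport M = \<Inter>{K. closed K \<and> emeasure M (- K) = 0}"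

lemma closed_msupport: "closed (msupport M)"
  unfolding msupport_def by auto

lemma msupport_least: "closed K \<Longrightarrow> emeasure M (- K) = 0 \<Longrightarrow> msupport M \<subseteq> K"
  unfolding msupport_def by auto

lemma null_msupport:
  assumes "sets M = sets borel"
  shows "emeasure M (- msupport M) = 0"
proof -
  let ?F = "{U. open U \<and> emeasure M U = 0}"
  have eq: "- msupport M = \<Union>?F"
  proof (intro set_eqI iffI)
    fix x assume "x \<in> - msupport M"
    then obtain K where "closed K" "emeasure M (- K) = 0" "x \<notin> K"
      unfolding msupport_def by auto
    then show "x \<in> \<Union>?F"
      by (intro UnionI[of "- K"]) (auto simp: open_Compl)
  next
    fix x assume "x \<in> \<Union>?F"
    then obtain U where "open U" "emeasure M U = 0" "x \<in> U"
      by auto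
    then show "x \<in> - msupport M"
      using msupport_least[of "- U" M] by (auto simp: closed_Compl)
  qed
  obtain F' where F': "F' \<subseteq> ?F" "countable F'" "\<Union>F' = \<Union>?F"
    using Lindelof[of ?F] by auto
  have "(\<Union>U\<in>F'. U) \<in> null_sets M"
    using F' assms by (intro null_sets_UN') (auto simp: null_sets_def)
  then show ?thesis
    using F'(3) eq by (auto simp: null_sets_def)
qed

lemma lookup_complexify [simp]:
  "Poly_Mapping.lookup (complexify f) k = complex_of_real (Poly_Mapping.lookup f k)"
  by (simp add: complexify_def Poly_Mapping.map.rep_eq when_def)

lemma complexify_add: "complexify (f + g) = complexify f + complexify g"
  by (rule poly_mapping_eqI) (simp add: lookup_add)

lemma complexify_mult: "complexify (f * g) = complexify f * complexify g"
proof (rule poly_mapping_eqI)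
  have sa: "complex_of_real (Sum_any h) = Sum_any (\<lambda>x. complex_of_real (h x))" for h :: "'b \<Rightarrow> real"
    by (simp add: Sum_any.expand_set)
  have wh: "complex_of_real (a when P) = (complex_of_real a when P)" for a P
    by (simp add: when_def)
  fix k
  show "Poly_Mapping.lookup (complexify (f * g)) k = Poly_Mapping.lookup (complexify f * complexify g) k"
    by (simp add: lookup_mult sa wh)
qed

lemma complex_decomposition:
  "f = complexify (pRe f) + Poly_Mapping.single 0 \<i> * complexify (pIm f)"
  unfolding mult_map_scale_conv_mult[symmetric]
  by (rule poly_mapping_eqI)
    (auto simp: complexify_def pRe_def pIm_def lookup_add Poly_Mapping.map.rep_eq when_def
      complex_eq_iff)

lemma complexify_pabs2: "complexify (pabs2 f) = f * pconj f"
proof -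
  have i2: "Poly_Mapping.single 0 \<i> * Poly_Mapping.single 0 \<i> = (- 1 :: ('n, complex) mvpoly)"
    by (simp add: mult_single flip: single_one single_uminus)
  have "f * pconj f = (complexify (pRe f) + Poly_Mapping.single 0 \<i> * complexify (pIm f)) * pconj f"
    using complex_decomposition[of f] by simp
  also have "\<dots> = complexify (pRe f) * complexify (pRe f)
      - (Poly_Mapping.single 0 \<i> * Poly_Mapping.single 0 \<i>) * (complexify (pIm f) * complexify (pIm f))"
    by (simp add: pconj_def algebra_simps)
  also have "\<dots> = complexify (pabs2 f)"
    unfolding i2 by (simp add: pabs2_def power2_eq_square complexify_add complexify_mult)
  finally show ?thesis ..
qed

end

theory Submission
  imports Defs
begin

text \<open>The hypothesis says that \<open>\<bar>q\<^sub>j\<^sub>k\<bar>\<^sup>2\<close> tends to \<open>1 / (1 + x\<^sub>j\<^sup>2)\<close> in a weighted \<open>L\<^sup>2(\<mu>)\<close>. Hence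
  \<open>\<integral> g h\<^sup>2 w \<partial>\<mu> \<ge> 0\<close> for polynomials \<open>h\<close> and a bounded weight \<open>w\<close> implies the same for the weight
  \<open>w / (1 + x\<^sub>j\<^sup>2)\<close>, because \<open>h\<^sup>2 \<bar>q\<^sub>j\<^sub>k\<bar>\<^sup>2\<close> is a sum of two squares; so \<open>\<integral> g h\<^sup>2 \<partial>\<mu> \<ge> 0\<close> even for
  fractions \<open>h\<close> whose denominators are products of the \<open>1 + x\<^sub>j\<^sup>2\<close>. By Stone-Weierstrass the
  polynomials in the bounded functions \<open>1 / (1 + x\<^sub>j\<^sup>2)\<close> and \<open>x\<^sub>j / (1 + x\<^sub>j\<^sup>2)\<close> approximate uniformly
  every continuous function of these, in particular a bump at a point where \<open>g\<close> is negative;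
  such a point therefore has a \<open>\<mu>\<close>-null neighbourhood.\<close>

section \<open>Evaluation of polynomials and integrability\<close>

text \<open>Updating at a fresh exponent is the same as adding a monomial. In this form the
  induction step matches additivity of \<open>peval\<close>, and multiplicativity reduces to
  products of two monomials.\<close>

lemma poly_mapping_single_induct [case_names zero single_add]:
  fixes p :: "'a \<Rightarrow>\<^sub>0 'b::comm_monoid_add"
  assumes "P 0" and "\<And>m c p. P p \<Longrightarrow> P (Poly_Mapping.single m c + p)"
  shows "P p"
proof (induction p rule: Poly_Mapping.update_induct)
  case const
  show ?case by fact
next
  case (update f a b)
  have "Poly_Mapping.update a b f = Poly_Mapping.single a b + f"
    using update(1)
    by (intro poly_mapping_eqI)
      (auto simp: lookup_update lookup_add lookup_single in_keys_iff when_def)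
  with update assms(2) show ?case by simp
qed

lemma monom_eval_0 [simp]: "monom_eval (Poly_Mapping.lookup 0) a = 1"
  by (simp add: monom_eval_def)

lemma monom_eval_add: 
  "monom_eval (Poly_Mapping.lookup (k + l)) a
    = monom_eval (Poly_Mapping.lookup k) a * monom_eval (Poly_Mapping.lookup l) a"
  by (simp add: monom_eval_def lookup_add power_add prod.distrib)

lemma borel_measurable_monom_eval [measurable]: "monom_eval k \<in> borel_measurable borel"
  unfolding monom_eval_def by measurable

lemma peval_eq_sum_superset:
  assumes "finite A" "Poly_Mapping.keys p \<subseteq> A"
  shows "peval p a = (\<Sum>m\<in>A. Poly_Mapping.lookup p m * monom_eval (Poly_Mapping.lookup m) a)"
  unfolding peval_def using assms by (intro sum.mono_neutral_left) (auto simp: in_keys_iff)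

lemma peval_0 [simp]: "peval 0 a = 0"
  by (simp add: peval_def)

lemma peval_add [simp]: "peval (p + q) a = peval p a + peval q a"
proof -
  let ?A = "Poly_Mapping.keys p \<union> Poly_Mapping.keys q"
  have "finite ?A" by simp
  then show ?thesis
    using keys_add[of p q]
    by (simp add: peval_eq_sum_superset[of ?A] lookup_add distrib_right sum.distrib)
qed

lemma peval_single [simp]:
  "peval (Poly_Mapping.single m c) a = c * monom_eval (Poly_Mapping.lookup m) a"
  by (subst peval_eq_sum_superset[of "{m}"]) auto

lemma peval_mult [simp]: "peval (p * q) a = peval p a * peval q a"
proof (induction p rule: poly_mapping_single_induct)
  case (single_add m c p)
  have "peval (Poly_Mapping.single m c * q) a = peval (Poly_Mapping.single m c) a * peval q a"
  proof (induction q rule: poly_mapping_single_induct)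
    case (single_add m' c' q)
    then show ?case
      by (simp add: distrib_left mult_single monom_eval_add)
  qed simp
  with single_add show ?case by (simp add: distrib_right)
qed simp

lemma peval_1 [simp]: "peval 1 a = 1"
  by (simp flip: single_one)

lemma peval_uminus [simp]: "peval (- p) a = - peval p a"
  by (simp add: peval_def sum_negf)

lemma peval_diff [simp]: "peval (p - q) a = peval p a - peval q a"
  using peval_add[of p "- q" a] by simp

lemma peval_power [simp]: "peval (p ^ k) a = peval p a ^ k"
  by (induction k) simp_all

lemma peval_pvar [simp]: "peval (pvar j) a = a $ j"
proof -
  have "monom_eval (Poly_Mapping.lookup (Poly_Mapping.single j 1)) a
      = (\<Prod>i\<in>UNIV. if i = j then a $ j else 1)"
    unfolding monom_eval_def by (intro prod.cong) (auto simp: lookup_single when_def)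
  then show ?thesis by (simp add: pvar_def prod.delta)
qed

lemma borel_measurable_peval [measurable]: "peval p \<in> borel_measurable borel"
  unfolding peval_def by measurable

lemma integrable_peval:
  assumes "borel_measure_with_moments M"
  shows "integrable M (peval p)"
  using assms unfolding peval_def borel_measure_with_moments_def
  by (intro Bochner_Integration.integrable_sum integrable_mult_right) auto

text \<open>Domination by \<open>B * peval p\<close>, which is integrable by finiteness of the
  moments. The factors \<open>r\<close> of interest are \<open>1 / weight js\<close> and squares of
  bounded functions of \<open>compactify x\<close>.\<close>

lemma integrable_peval_mult_bounded:
  fixes r :: "real ^ 'n::finite \<Rightarrow> real"
  assumes M: "borel_measure_with_moments M"
    and r: "r \<in> borel_measurable borel" "\<And>x. \<bar>r x\<bar> \<le> B"
  shows "integrable M (\<lambda>x. peval p x * r x)"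
proof -
  have [measurable_cong]: "sets M = sets borel"
    using M by (simp add: borel_measure_with_moments_def)
  note [measurable] = r(1)
  show ?thesis
  proof (rule Bochner_Integration.integrable_bound)
    show "integrable M (\<lambda>x. B * peval p x)"
      using integrable_peval[OF M] by simp
    show "AE x in M. norm (peval p x * r x) \<le> norm (B * peval p x)"
    proof (rule AE_I2)
      fix x
      have "\<bar>peval p x\<bar> * \<bar>r x\<bar> \<le> \<bar>peval p x\<bar> * \<bar>B\<bar>"
        using r(2)[of x] by (intro mult_left_mono) auto
      then show "norm (peval p x * r x) \<le> norm (B * peval p x)"
        by (simp add: abs_mult mult.commute)
    qed
  qed measurable
qed

section \<open>The limit condition in real terms\<close>

lemma complexify_pvar: "complexify (pvar j) = pvar j"
  by (rule poly_mapping_eqI) (simp add: pvar_def lookup_single when_def)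

lemma complexify_1: "complexify 1 = 1"
  by (rule poly_mapping_eqI) (simp add: lookup_one when_def)

lemma complexify_diff: "complexify (f - g) = complexify f - complexify g"
  by (rule poly_mapping_eqI) (simp add: lookup_minus)

lemma pabs2_complexify [simp]: "pabs2 (complexify f) = f\<^sup>2"
proof -
  have "pRe (complexify f) = f" "pIm (complexify f) = 0"
    by (auto intro!: poly_mapping_eqI simp: pRe_def pIm_def Poly_Mapping.map.rep_eq when_def)
  then show ?thesis by (simp add: pabs2_def)
qed

text \<open>Since \<open>q * pconj q\<close> is the complexification of \<open>pabs2 q\<close>, the
  argument on the left is a real polynomial, and \<open>pabs2\<close> of a real polynomial is its
  square. This turns the limit condition into L2 convergence.\<close>

lemma pabs2_one_minus:
  "pabs2 (1 - (1 + (pvar j)\<^sup>2) * q * pconj q) = (1 - (1 + (pvar j)\<^sup>2) * pabs2 q)\<^sup>2"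
proof -
  have "1 - (1 + (pvar j)\<^sup>2) * q * pconj q = complexify (1 - (1 + (pvar j)\<^sup>2) * pabs2 q)"
    by (simp add: complexify_diff complexify_mult complexify_add complexify_1 complexify_pvar
        complexify_pabs2 power2_eq_square mult.assoc)
  then show ?thesis by (metis pabs2_complexify)
qed

section \<open>Positivity with denominators\<close>

text \<open>A list allows repeated factors, makes products of weights correspond to
  \<open>@\<close>, and lets induction introduce one denominator at a time.\<close>

definition weight :: "'n list \<Rightarrow> real ^ 'n \<Rightarrow> real"
  where "weight js x = (\<Prod>j\<leftarrow>js. 1 + (x $ j)\<^sup>2)"

lemma weight_Nil [simp]: "weight [] x = 1"
  and weight_Cons [simp]: "weight (j # js) x = (1 + (x $ j)\<^sup>2) * weight js x"
  and weight_append: "weight (js @ ks) x = weight js x * weight ks x"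
  by (simp_all add: weight_def)

lemma weight_ge_1: "1 \<le> weight js x"
proof (induction js)
  case (Cons j js)
  then have "1 * 1 \<le> (1 + (x $ j)\<^sup>2) * weight js x" by (intro mult_mono) auto
  then show ?case by simp
qed simp

lemma weight_pos [simp]: "0 < weight js x"
  using weight_ge_1[of js x] by linarith

lemma weight_nonzero [simp]: "weight js x \<noteq> 0"
  using weight_pos[of js x] by linarith

lemma abs_inverse_weight_le_1: "\<bar>1 / weight js x\<bar> \<le> 1"
  using weight_ge_1[of js x] by simp

lemma borel_measurable_weight [measurable]: "weight js \<in> borel_measurable borel"
  by (induction js) (simp_all add: weight_def[abs_def])

lemma ex_peval_weight: "\<exists>p. \<forall>x. peval p x = weight js x"
proof (induction js)
  case Nil
  show ?case by (intro exI[of _ 1]) simp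
next
  case (Cons j js)
  then obtain p where "\<And>x. peval p x = weight js x" by blast
  then show ?case by (intro exI[of _ "(1 + (pvar j)\<^sup>2) * p"]) simp
qed

lemma integral_weight_nonneg:
  fixes M :: "(real ^ 'n::finite) measure"
  assumes M: "borel_measure_with_moments M"
    and q: "\<And>j. \<exists>s :: nat \<Rightarrow> ('n, complex) mvpoly.
      (\<lambda>k. \<integral>x. (1 - (1 + (x $ j)\<^sup>2) * peval (pabs2 (s k)) x)\<^sup>2 \<partial>M) \<longlonglongrightarrow> 0"
    and g: "\<And>h. 0 \<le> (\<integral>x. peval (g * h\<^sup>2) x \<partial>M)"
  shows "0 \<le> (\<integral>x. peval (g * h\<^sup>2) x * (1 / weight js x) \<partial>M)"
\<comment> \<open>\<open>h\<close> must vary: the induction hypothesis is applied to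
  \<open>h\<close> times the real and the imaginary part of \<open>s k\<close>.\<close>
proof (induction js arbitrary: h)
  case Nil
  show ?case using g by simp
next
  case (Cons j js)
  define G where "G = peval (g * h\<^sup>2)"
  define I where "I = (\<integral>x. G x * (1 / weight (j # js) x) \<partial>M)"
  obtain s :: "nat \<Rightarrow> ('n, complex) mvpoly" where s:
    "(\<lambda>k. \<integral>x. (1 - (1 + (x $ j)\<^sup>2) * peval (pabs2 (s k)) x)\<^sup>2 \<partial>M) \<longlonglongrightarrow> 0"
    using q by blast
  define e where "e k = 1 - (1 + (pvar j)\<^sup>2) * pabs2 (s k)" for k
  have e_eval: "peval (e k) x = 1 - (1 + (x $ j)\<^sup>2) * peval (pabs2 (s k)) x" for k x
    by (simp add: e_def)
  have int: "integrable M (\<lambda>x. peval p x * (1 / weight js x))" for p js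
    by (rule integrable_peval_mult_bounded[OF M _ abs_inverse_weight_le_1]) measurable
  \<comment> \<open>Replacing \<open>1 / (1 + (x $ j)\<^sup>2)\<close> by \<open>pabs2 (s k)\<close>
    costs an error bounded by \<open>\<bar>G * e k\<bar>\<close>. Only the L2 norm of
    \<open>e k\<close> is known to be small, so the product is split by the arithmetic-geometric
    mean inequality with a free parameter \<open>t\<close>, in place of Cauchy-Schwarz.\<close>
  have lower: "- (t * (\<integral>x. (G x)\<^sup>2 \<partial>M) + (\<integral>x. (peval (e k) x)\<^sup>2 \<partial>M) / t) \<le> I" if "t > 0" for t k
  proof -
    define J where "J = (\<integral>x. peval (g * h\<^sup>2 * pabs2 (s k)) x * (1 / weight js x) \<partial>M)"
    have "peval (g * h\<^sup>2 * pabs2 (s k)) x * (1 / weight js x)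
        = peval (g * (h * pRe (s k))\<^sup>2) x * (1 / weight js x)
          + peval (g * (h * pIm (s k))\<^sup>2) x * (1 / weight js x)" for x
      by (simp add: pabs2_def field_simps)
    then have "J = (\<integral>x. peval (g * (h * pRe (s k))\<^sup>2) x * (1 / weight js x) \<partial>M)
        + (\<integral>x. peval (g * (h * pIm (s k))\<^sup>2) x * (1 / weight js x) \<partial>M)"
      unfolding J_def by (simp only: Bochner_Integration.integral_add[OF int int])
    with Cons.IH[of "h * pRe (s k)"] Cons.IH[of "h * pIm (s k)"] have "0 \<le> J" by linarith
    have intsq: "integrable M (\<lambda>x. (peval p x)\<^sup>2)" for p
    proof -
      have "(\<lambda>x. (peval p x)\<^sup>2) = peval (p\<^sup>2)" by (rule ext) simp
      with integrable_peval[OF M, of "p\<^sup>2"] show ?thesis by simp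
    qed
    have intG: "integrable M (\<lambda>x. t * (G x)\<^sup>2)"
      unfolding G_def by (intro integrable_mult_right intsq)
    have inte: "integrable M (\<lambda>x. (peval (e k) x)\<^sup>2 / t)"
      by (intro integrable_divide_zero intsq)
    have "J - (t * (\<integral>x. (G x)\<^sup>2 \<partial>M) + (\<integral>x. (peval (e k) x)\<^sup>2 \<partial>M) / t)
        = (\<integral>x. peval (g * h\<^sup>2 * pabs2 (s k)) x * (1 / weight js x)
            - (t * (G x)\<^sup>2 + (peval (e k) x)\<^sup>2 / t) \<partial>M)"
      unfolding J_def
      by (simp only: Bochner_Integration.integral_diff[OF int Bochner_Integration.integrable_add[OF intG inte]]
          Bochner_Integration.integral_add[OF intG inte]
          integral_mult_right_zero integral_divide_zero)
    also have "\<dots> \<le> I"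
      unfolding I_def
    proof (rule integral_mono)
      fix x
      define u where "u = 1 / weight (j # js) x"
      have "0 \<le> u" "u \<le> 1"
        using weight_ge_1[of "j # js" x] by (auto simp: u_def simp del: weight_Cons)
      have js: "1 / weight js x = (1 + (x $ j)\<^sup>2) * u"
        using weight_pos[of js x] by (simp add: u_def add_nonneg_eq_0_iff)
      have "\<bar>G x * peval (e k) x\<bar> \<le> t * (G x)\<^sup>2 + (peval (e k) x)\<^sup>2 / t"
      proof -
        have "0 \<le> (t * \<bar>G x\<bar> - \<bar>peval (e k) x\<bar>)\<^sup>2" by simp
        then have "2 * (t * \<bar>G x * peval (e k) x\<bar>) \<le> t\<^sup>2 * (G x)\<^sup>2 + (peval (e k) x)\<^sup>2"
          by (simp add: power2_diff power_mult_distrib abs_mult algebra_simps)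
        moreover have "0 \<le> t * \<bar>G x * peval (e k) x\<bar>" using \<open>t > 0\<close> by simp
        ultimately have "t * \<bar>G x * peval (e k) x\<bar> \<le> t\<^sup>2 * (G x)\<^sup>2 + (peval (e k) x)\<^sup>2"
          by linarith
        with \<open>t > 0\<close> show ?thesis by (simp add: field_simps power2_eq_square)
      qed
      moreover have "\<bar>G x * peval (e k) x\<bar> * u \<le> \<bar>G x * peval (e k) x\<bar>"
        using \<open>u \<le> 1\<close> by (rule mult_left_le) simp
      moreover have "- (G x * peval (e k) x * u) \<le> \<bar>G x * peval (e k) x\<bar> * u"
        using \<open>0 \<le> u\<close> mult_right_mono[of "- (G x * peval (e k) x)" "\<bar>G x * peval (e k) x\<bar>" u] by simp
      \<comment> \<open>By definition of \<open>e k\<close>, the product of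
        \<open>1 + (x $ j)\<^sup>2\<close> and \<open>pabs2 (s k)\<close> evaluates to 1 -
        \<open>e k\<close>.\<close>
      moreover have "peval (g * h\<^sup>2 * pabs2 (s k)) x * (1 / weight js x)
          = G x * u - G x * peval (e k) x * u"
        unfolding js e_eval by (simp add: G_def algebra_simps)
      ultimately show "peval (g * h\<^sup>2 * pabs2 (s k)) x * (1 / weight js x)
            - (t * (G x)\<^sup>2 + (peval (e k) x)\<^sup>2 / t) \<le> G x * (1 / weight (j # js) x)"
        unfolding u_def[symmetric] by linarith
    next
      show "integrable M (\<lambda>x. G x * (1 / weight (j # js) x))"
        unfolding G_def by (rule int)
    qed (intro Bochner_Integration.integrable_diff Bochner_Integration.integrable_add int intG inte)
    finally show ?thesis using \<open>0 \<le> J\<close> by linarith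
  qed
  \<comment> \<open>The order of limits matters: first \<open>k\<close> tends to infinity for fixed
    \<open>t\<close>, which removes the term divided by \<open>t\<close>; then \<open>t\<close>
    tends to 0.\<close>
  have lower': "- (t * (\<integral>x. (G x)\<^sup>2 \<partial>M)) \<le> I" if "t > 0" for t
  proof (rule LIMSEQ_le_const2)
    show "(\<lambda>k. - (t * (\<integral>x. (G x)\<^sup>2 \<partial>M) + (\<integral>x. (peval (e k) x)\<^sup>2 \<partial>M) / t))
        \<longlonglongrightarrow> - (t * (\<integral>x. (G x)\<^sup>2 \<partial>M))"
      using s \<open>t > 0\<close> unfolding e_eval by (auto intro!: tendsto_eq_intros)
  qed (use lower[OF that] in auto)
  have "((\<lambda>t. - (t * (\<integral>x. (G x)\<^sup>2 \<partial>M))) \<longlongrightarrow> 0) (at_right 0)"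
    by (auto intro!: tendsto_eq_intros)
  then have "0 \<le> I"
    by (rule tendsto_upperbound)
      (use lower' in \<open>auto simp: eventually_at_right_less intro!: eventually_at_rightI[of 0 1]\<close>)
  then show ?case by (simp only: I_def G_def)
qed

section \<open>The algebra of fractions with weight denominators\<close>

text \<open>These are the functions given by the localization of the polynomial ring at the elements
  \<open>1 + (pvar j)\<^sup>2\<close>.\<close>

definition regular_frac :: "(real ^ 'n::finite \<Rightarrow> real) \<Rightarrow> bool"
  where "regular_frac h \<longleftrightarrow> (\<exists>js p. \<forall>x. h x * weight js x = peval p x)"

lemma regular_frac_const: "regular_frac (\<lambda>x. c)"
  unfolding regular_frac_def
  by (intro exI[of _ "[]"] exI[of _ "Poly_Mapping.single 0 c"]) simp

lemma regular_frac_mult: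
  assumes "regular_frac f" "regular_frac h"
  shows "regular_frac (\<lambda>x. f x * h x)"
proof -
  obtain js p where 1: "\<And>x. f x * weight js x = peval p x"
    using assms(1) unfolding regular_frac_def by blast
  obtain ks r where 2: "\<And>x. h x * weight ks x = peval r x"
    using assms(2) unfolding regular_frac_def by blast
  show ?thesis
    unfolding regular_frac_def
    by (intro exI[of _ "js @ ks"] exI[of _ "p * r"])
      (simp add: weight_append flip: 1 2)
qed

lemma regular_frac_add:
  assumes "regular_frac f" "regular_frac h"
  shows "regular_frac (\<lambda>x. f x + h x)"
proof -
  obtain js p where 1: "\<And>x. f x * weight js x = peval p x"
    using assms(1) unfolding regular_frac_def by blast
  obtain ks r where 2: "\<And>x. h x * weight ks x = peval r x"
    using assms(2) unfolding regular_frac_def by blast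
  \<comment> \<open>Cross-multiplication puts the weights into the numerator, so they are needed as
    polynomials.\<close>
  obtain v w where vw: "\<And>x. peval v x = weight js x" "\<And>x. peval w x = weight ks x"
    using ex_peval_weight by metis
  show ?thesis
    unfolding regular_frac_def
    by (intro exI[of _ "js @ ks"] exI[of _ "p * w + v * r"])
      (simp add: weight_append vw algebra_simps flip: 1 2)
qed

lemma regular_frac_sum:
  assumes "\<And>i. i \<in> I \<Longrightarrow> regular_frac (f i)"
  shows "regular_frac (\<lambda>x. \<Sum>i\<in>I. f i x)"
  using assms
  by (induction I rule: infinite_finite_induct) (auto intro: regular_frac_const regular_frac_add)

section \<open>Compactification and uniform approximation\<close>

text \<open>In each coordinate this is an inverse stereographic projection: s = 1/(1+t^2) and u =
  t/(1+t^2) satisfy s^2 + u^2 = s, a circle through the origin, which is the missing point at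
  infinity; t is recovered as u/s.\<close>

definition compactify :: "real ^ 'n::finite \<Rightarrow> (real ^ 'n) \<times> (real ^ 'n)"
  where "compactify x = (\<chi> j. 1 / (1 + (x $ j)\<^sup>2), \<chi> j. x $ j / (1 + (x $ j)\<^sup>2))"

lemma one_plus_square_nonzero: "1 + (t::real)\<^sup>2 \<noteq> 0"
  by (simp add: add_nonneg_eq_0_iff)

lemma continuous_on_compactify: "continuous_on A compactify"
  unfolding compactify_def
  by (intro continuous_intros ballI one_plus_square_nonzero)

lemma borel_measurable_compactify [measurable]: "compactify \<in> borel_measurable borel"
  by (intro borel_measurable_continuous_onI continuous_on_compactify)

lemma bounded_range_compactify: "bounded (range (compactify :: real ^ 'n::finite \<Rightarrow> _))"
proof (rule boundedI)
  fix y assume "y \<in> range (compactify :: real ^ 'n \<Rightarrow> _)"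
  then obtain x :: "real ^ 'n" where y: "y = compactify x" by blast
  have bound: "\<bar>1 / (1 + t\<^sup>2)\<bar> \<le> 1" "\<bar>t / (1 + t\<^sup>2)\<bar> \<le> 1" for t :: real
  proof -
    have "0 \<le> (\<bar>t\<bar> - 1)\<^sup>2" by simp
    then have "2 * \<bar>t\<bar> \<le> 1 + t\<^sup>2" by (simp add: power2_diff)
    then have "\<bar>t\<bar> \<le> 1 + t\<^sup>2" by linarith
    moreover have "0 < 1 + t\<^sup>2" by (simp add: add_pos_nonneg)
    ultimately show "\<bar>1 / (1 + t\<^sup>2)\<bar> \<le> 1" "\<bar>t / (1 + t\<^sup>2)\<bar> \<le> 1"
      by (simp_all add: abs_of_pos)
  qed
  have "\<bar>fst y $ i\<bar> \<le> 1" "\<bar>snd y $ i\<bar> \<le> 1" for i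
    using bound[of "x $ i"] by (simp_all only: y compactify_def fst_conv snd_conv vec_lambda_beta)
  then have "(\<Sum>i\<in>UNIV. \<bar>fst y $ i\<bar>) \<le> CARD('n)" "(\<Sum>i\<in>UNIV. \<bar>snd y $ i\<bar>) \<le> CARD('n)"
    using sum_bounded_above[of UNIV "\<lambda>i. \<bar>fst y $ i\<bar>" 1]
      sum_bounded_above[of UNIV "\<lambda>i. \<bar>snd y $ i\<bar>" 1] by simp_all
  then show "norm y \<le> 2 * CARD('n)"
    using norm_le_l1_cart[of "fst y"] norm_le_l1_cart[of "snd y"] norm_Pair_le[of "fst y" "snd y"]
    by simp
qed

lemma regular_frac_real_polynomial:
  assumes "real_polynomial_function p"
  shows "regular_frac (\<lambda>x :: real ^ 'n::finite. p (compactify x))"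
  using assms
proof (induction p rule: real_polynomial_function.induct)
  case (linear f)
  interpret bounded_linear f by fact
  have "f (compactify x) = (\<Sum>j\<in>UNIV. (1 / (1 + (x $ j)\<^sup>2)) * f (axis j 1, 0))
      + (\<Sum>j\<in>UNIV. (x $ j / (1 + (x $ j)\<^sup>2)) * f (0, axis j 1))" for x :: "real ^ 'n"
  proof -
    have vec: "(\<chi> j. c j) = (\<Sum>j\<in>UNIV. c j *\<^sub>R axis j (1::real))" for c :: "'n \<Rightarrow> real"
      using basis_expansion[of "\<chi> j. c j"] by (simp add: scalar_mult_eq_scaleR)
    have split: "f (u, v) = f (u, 0) + f (0, v)" for u v
      using add[of "(u, 0)" "(0, v)"] by simp
    have fst: "f (\<Sum>j\<in>UNIV. c j *\<^sub>R axis j 1, 0) = (\<Sum>j\<in>UNIV. c j * f (axis j 1, 0))"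
      for c :: "'n \<Rightarrow> real"
    proof -
      have eq: "(\<Sum>j\<in>UNIV. c j *\<^sub>R axis j 1, 0) = (\<Sum>j\<in>UNIV. c j *\<^sub>R (axis j (1::real), 0 :: real ^ 'n))"
        by (simp add: prod_eq_iff fst_sum snd_sum)
      show ?thesis unfolding eq by (simp only: sum scaleR real_scaleR_def)
    qed
    have snd: "f (0, \<Sum>j\<in>UNIV. c j *\<^sub>R axis j 1) = (\<Sum>j\<in>UNIV. c j * f (0, axis j 1))"
      for c :: "'n \<Rightarrow> real"
    proof -
      have eq: "(0, \<Sum>j\<in>UNIV. c j *\<^sub>R axis j 1) = (\<Sum>j\<in>UNIV. c j *\<^sub>R (0 :: real ^ 'n, axis j (1::real)))"
        by (simp add: prod_eq_iff fst_sum snd_sum)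
      show ?thesis unfolding eq by (simp only: sum scaleR real_scaleR_def)
    qed
    show ?thesis
      unfolding compactify_def by (subst split) (simp only: vec fst snd)
  qed
  moreover have "regular_frac (\<lambda>x :: real ^ 'n. 1 / (1 + (x $ j)\<^sup>2))" for j
    unfolding regular_frac_def
    by (intro exI[of _ "[j]"] exI[of _ 1]) (simp add: one_plus_square_nonzero)
  moreover have "regular_frac (\<lambda>x :: real ^ 'n. x $ j / (1 + (x $ j)\<^sup>2))" for j
    unfolding regular_frac_def
    by (intro exI[of _ "[j]"] exI[of _ "pvar j"]) (simp add: one_plus_square_nonzero)
  ultimately show ?case
    by (simp only:) (intro regular_frac_add regular_frac_sum regular_frac_mult regular_frac_const)
qed (intro regular_frac_const regular_frac_add regular_frac_mult; assumption)+

lemma integral_compactify_nonneg: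
  fixes M :: "(real ^ 'n::finite) measure"
  assumes M: "borel_measure_with_moments M"
    and g: "\<And>h js. 0 \<le> (\<integral>x. peval (g * h\<^sup>2) x * (1 / weight js x) \<partial>M)"
    and \<psi>: "continuous_on UNIV \<psi>"
  shows "0 \<le> (\<integral>x. peval g x * (\<psi> (compactify x))\<^sup>2 \<partial>M)"
proof -
  \<comment> \<open>The range omits its limits at infinity; the closure supplies the compact set
    that Stone-Weierstrass requires.\<close>
  define K where "K = closure (range (compactify :: real ^ 'n \<Rightarrow> _))"
  have "compact K"
    unfolding K_def using bounded_range_compactify by (simp add: compact_closure)
  have inK: "compactify x \<in> K" for x
    unfolding K_def by (rule closure_subset[THEN subsetD]) simp
  have contK: "continuous_on K \<psi>"
    using \<psi> by (rule continuous_on_subset) simp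
  have "bounded (\<psi> ` K)"
    by (intro compact_imp_bounded compact_continuous_image contK \<open>compact K\<close>)
  then obtain B where B: "\<And>y. y \<in> K \<Longrightarrow> \<bar>\<psi> y\<bar> \<le> B"
    unfolding bounded_iff by auto
  have [measurable]: "\<psi> \<in> borel_measurable borel"
    using \<psi> by (rule borel_measurable_continuous_onI)
  define A where "A = (\<integral>x. \<bar>peval g x\<bar> \<partial>M)"
  have int\<psi>: "integrable M (\<lambda>x. peval g x * (\<psi> (compactify x))\<^sup>2)"
  proof (rule integrable_peval_mult_bounded[OF M])
    show "\<bar>(\<psi> (compactify x))\<^sup>2\<bar> \<le> B\<^sup>2" for x
      using power_mono[OF B[OF inK[of x]], of 2] by simp
  qed measurable
  \<comment> \<open>If \<open>\<bar>a\<bar> \<le> B\<close> and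
    \<open>\<bar>a - b\<bar> < \<epsilon> < 1\<close>, then
    \<open>\<bar>a + b\<bar> \<le> 2 * B + 1\<close>, so the squares differ by at most
    \<open>\<epsilon> * (2 * B + 1)\<close>. Integrating against
    \<open>\<bar>peval g x\<bar>\<close> yields the factor \<open>A\<close>.\<close>
  have lower: "- (\<epsilon> * (2 * B + 1) * A) \<le> (\<integral>x. peval g x * (\<psi> (compactify x))\<^sup>2 \<partial>M)"
    if \<epsilon>: "0 < \<epsilon>" "\<epsilon> < 1" for \<epsilon>
  proof -
    obtain p where p: "real_polynomial_function p" "\<And>y. y \<in> K \<Longrightarrow> \<bar>\<psi> y - p y\<bar> < \<epsilon>"
      using Stone_Weierstrass_real_polynomial_function[OF \<open>compact K\<close> contK \<epsilon>(1)]
      by blast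
    obtain js f where f: "\<And>x. p (compactify x) * weight js x = peval f x"
      using regular_frac_real_polynomial[OF p(1)] unfolding regular_frac_def by blast
    \<comment> \<open>Squaring the fraction squares its denominator, whence
      \<open>js @ js\<close>.\<close>
    have eq: "peval g x * (p (compactify x))\<^sup>2 = peval (g * f\<^sup>2) x * (1 / weight (js @ js) x)" for x
      by (simp add: weight_append power2_eq_square flip: f)
    have "0 \<le> (\<integral>x. peval g x * (p (compactify x))\<^sup>2 \<partial>M)"
      unfolding eq by (rule g)
    have intp: "integrable M (\<lambda>x. peval g x * (p (compactify x))\<^sup>2)"
      unfolding eq
      by (rule integrable_peval_mult_bounded[OF M, of _ 1])
        (measurable, rule abs_inverse_weight_le_1)
    have "(\<integral>x. peval g x * (p (compactify x))\<^sup>2 \<partial>M) - \<epsilon> * (2 * B + 1) * A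
        = (\<integral>x. peval g x * (p (compactify x))\<^sup>2 - \<epsilon> * (2 * B + 1) * \<bar>peval g x\<bar> \<partial>M)"
      unfolding A_def using intp integrable_peval[OF M]
      by (subst Bochner_Integration.integral_diff) auto
    also have "\<dots> \<le> (\<integral>x. peval g x * (\<psi> (compactify x))\<^sup>2 \<partial>M)"
    proof (rule integral_mono)
      fix x
      define a b where "a = \<psi> (compactify x)" and "b = p (compactify x)"
      have "\<bar>a\<bar> \<le> B" "\<bar>a - b\<bar> < \<epsilon>"
        unfolding a_def b_def using B p(2) inK by auto
      then have "\<bar>b + a\<bar> \<le> 2 * B + 1" using \<epsilon> by linarith
      then have "\<bar>a - b\<bar> * \<bar>b + a\<bar> \<le> \<epsilon> * (2 * B + 1)"
        using \<open>\<bar>a - b\<bar> < \<epsilon>\<close> by (intro mult_mono) auto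
      then have "\<bar>b\<^sup>2 - a\<^sup>2\<bar> \<le> \<epsilon> * (2 * B + 1)"
        by (simp add: power2_eq_square square_diff_square_factored abs_mult mult.commute
            abs_minus_commute)
      then have "\<bar>peval g x\<bar> * \<bar>b\<^sup>2 - a\<^sup>2\<bar> \<le> \<bar>peval g x\<bar> * (\<epsilon> * (2 * B + 1))"
        by (rule mult_left_mono) simp
      then have "peval g x * (b\<^sup>2 - a\<^sup>2) \<le> \<epsilon> * (2 * B + 1) * \<bar>peval g x\<bar>"
        using abs_ge_self[of "peval g x * (b\<^sup>2 - a\<^sup>2)"] unfolding abs_mult by (simp add: mult.commute)
      then show "peval g x * (p (compactify x))\<^sup>2 - \<epsilon> * (2 * B + 1) * \<bar>peval g x\<bar>
          \<le> peval g x * (\<psi> (compactify x))\<^sup>2"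
        unfolding a_def[symmetric] b_def[symmetric] by (simp add: right_diff_distrib)
    qed (use intp int\<psi> integrable_peval[OF M] in auto)
    finally show ?thesis
      using \<open>0 \<le> (\<integral>x. peval g x * (p (compactify x))\<^sup>2 \<partial>M)\<close> by linarith
  qed
  have "((\<lambda>\<epsilon>. - (\<epsilon> * (2 * B + 1) * A)) \<longlongrightarrow> 0) (at_right 0)"
    by (auto intro!: tendsto_eq_intros)
  then show ?thesis
    by (rule tendsto_upperbound)
      (use lower in \<open>auto intro!: eventually_at_rightI[of 0 1]\<close>)
qed

text \<open>The test function is a bump at \<open>compactify a\<close>. Since \<open>x $ j = snd (compactify x) $ j /
  fst (compactify x) $ j\<close>, the value \<open>peval g x\<close> depends continuously on \<open>compactify x\<close>,
  so \<open>peval g\<close> is negative wherever the bump is nonzero.\<close>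

lemma not_in_msupport_if_negative:
  fixes M :: "(real ^ 'n::finite) measure"
  assumes M: "borel_measure_with_moments M"
    and g: "\<And>\<psi>. continuous_on UNIV \<psi> \<Longrightarrow> 0 \<le> (\<integral>x. peval g x * (\<psi> (compactify x))\<^sup>2 \<partial>M)"
    and neg: "peval g a < 0"
  shows "a \<notin> msupport M"
proof -
  have setsM [measurable_cong]: "sets M = sets borel"
    using M by (simp add: borel_measure_with_moments_def)
  define F where "F y = peval g (\<chi> j. snd y $ j / fst y $ j)" for y :: "(real ^ 'n) \<times> (real ^ 'n)"
  have F: "F (compactify x) = peval g x" for x
  proof -
    have "(\<chi> j. snd (compactify x) $ j / fst (compactify x) $ j) = x"
      by (simp add: vec_eq_iff compactify_def one_plus_square_nonzero)
    then show ?thesis by (simp add: F_def)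
  qed
  \<comment> \<open>\<open>F\<close> is total only through division by zero, but continuity is
    needed only at \<open>compactify a\<close>, where all first components are nonzero.\<close>
  have "isCont F (compactify a)"
    unfolding F_def peval_def monom_eval_def vec_lambda_beta
    by (intro continuous_intros) (simp add: compactify_def one_plus_square_nonzero)
  then have "\<forall>\<^sub>F y in at (compactify a). F y < 0"
    using neg order_tendstoD(2)[of F "F (compactify a)" "at (compactify a)" 0]
    by (simp add: isCont_def F)
  then obtain \<delta> where "\<delta> > 0"
    and ne: "\<And>y. y \<noteq> compactify a \<Longrightarrow> dist y (compactify a) < \<delta> \<Longrightarrow> F y < 0"
    unfolding eventually_at by blast
  have \<delta>: "F y < 0" if "dist y (compactify a) < \<delta>" for y
    using ne[OF _ that] neg by (cases "y = compactify a") (auto simp: F)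
  \<comment> \<open>A bump positive exactly on the open ball of radius \<open>\<delta>\<close>,
    where \<open>F\<close> is negative.\<close>
  define \<psi> where "\<psi> y = max 0 (\<delta> - dist y (compactify a))" for y
  have \<psi>: "continuous_on UNIV \<psi>"
    unfolding \<psi>_def by (intro continuous_intros)
  have [measurable]: "\<psi> \<in> borel_measurable borel"
    using \<psi> by (rule borel_measurable_continuous_onI)
  have nonpos: "peval g x * (\<psi> (compactify x))\<^sup>2 \<le> 0" for x
    using \<delta>[of "compactify x"]
    by (cases "dist (compactify x) (compactify a) < \<delta>")
      (auto simp: F \<psi>_def max_def intro!: mult_nonpos_nonneg)
  have int: "integrable M (\<lambda>x. - (peval g x * (\<psi> (compactify x))\<^sup>2))"
  proof (intro Bochner_Integration.integrable_minus integrable_peval_mult_bounded[OF M])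
    show "\<bar>(\<psi> (compactify x))\<^sup>2\<bar> \<le> \<delta>\<^sup>2" for x
      using \<open>\<delta> > 0\<close> by (auto simp: \<psi>_def max_def intro!: power_mono)
  qed measurable
  \<comment> \<open>Positivity from \<open>g\<close> meets the pointwise bound
    \<open>nonpos\<close>, so the integral vanishes and the integrand is zero almost everywhere; it
    is nonzero on \<open>U\<close>.\<close>
  have "(\<integral>x. - (peval g x * (\<psi> (compactify x))\<^sup>2) \<partial>M) = 0"
    using g[OF \<psi>] Bochner_Integration.integral_nonneg[of M "\<lambda>x. - (peval g x * (\<psi> (compactify x))\<^sup>2)"] nonpos
    by simp
  then have "AE x in M. - (peval g x * (\<psi> (compactify x))\<^sup>2) = 0"
    using integral_nonneg_eq_0_iff_AE[OF int] nonpos by simp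
  define U where "U = compactify -` ball (compactify a) \<delta>"
  have "AE x in M. x \<notin> U"
    using \<open>AE x in M. - (peval g x * (\<psi> (compactify x))\<^sup>2) = 0\<close>
  proof eventually_elim
    case (elim x)
    show ?case
    proof
      assume "x \<in> U"
      then have "dist (compactify x) (compactify a) < \<delta>"
        by (simp add: U_def dist_commute)
      with \<delta>[OF this] elim show False
        by (simp add: F \<psi>_def)
    qed
  qed
  moreover have "open U"
    unfolding U_def using continuous_on_compactify by (intro open_vimage) auto
  ultimately have "emeasure M U = 0"
    using AE_iff_measurable[of U M "\<lambda>x. x \<notin> U"] setsM sets_eq_imp_space_eq[OF setsM] by simp
  then have "msupport M \<subseteq> - U"
    using \<open>open U\<close> by (intro msupport_least) (auto simp: closed_Compl)
  moreover have "a \<in> U" using \<open>\<delta> > 0\<close> by (simp add: U_def)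
  ultimately show ?thesis by blast
qed

theorem theorem0p5:
  fixes L :: "('n::finite, real) mvpoly \<Rightarrow> real"
    and M :: "(real ^ 'n) measure"
    and g :: "('n, real) mvpoly"
  assumes "psd L"
    and "\<And>j :: 'n. \<exists>q :: nat \<Rightarrow> ('n, complex) mvpoly.
           (\<lambda>k. L (pabs2 (1 - (1 + (pvar j)\<^sup>2) * q k * pconj (q k)))) \<longlonglongrightarrow> 0"
    and "borel_measure_with_moments M"
    and "L = moment_functional M"
    and "\<And>h :: ('n, real) mvpoly. L (g * h\<^sup>2) \<ge> 0"
  shows "msupport M \<subseteq> {a. peval g a \<ge> 0}"
proof -
  \<comment> \<open>Through \<open>L = moment_functional M\<close> the limit condition says that
    \<open>1 + (x $ j)\<^sup>2\<close> times \<open>pabs2 (q k)\<close> tends to 1 in L2 of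
    \<open>M\<close>.\<close>
  have q: "\<exists>q :: nat \<Rightarrow> ('n, complex) mvpoly.
      (\<lambda>k. \<integral>x. (1 - (1 + (x $ j)\<^sup>2) * peval (pabs2 (q k)) x)\<^sup>2 \<partial>M) \<longlonglongrightarrow> 0" for j
  proof -
    have "L (pabs2 (1 - (1 + (pvar j)\<^sup>2) * r * pconj r))
        = (\<integral>x. (1 - (1 + (x $ j)\<^sup>2) * peval (pabs2 r) x)\<^sup>2 \<partial>M)" for r
      unfolding assms(4) pabs2_one_minus moment_functional_def
      by (rule Bochner_Integration.integral_cong) simp_all
    with assms(2)[of j] show ?thesis by simp
  qed
  have g: "0 \<le> (\<integral>x. peval (g * h\<^sup>2) x \<partial>M)" for h
    using assms(5)[of h] unfolding assms(4) moment_functional_def .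
  have "0 \<le> (\<integral>x. peval g x * (\<psi> (compactify x))\<^sup>2 \<partial>M)" if "continuous_on UNIV \<psi>" for \<psi>
    by (intro integral_compactify_nonneg[OF assms(3) _ that] integral_weight_nonneg[OF assms(3) q g])
  then have "a \<notin> msupport M" if "peval g a < 0" for a
    using not_in_msupport_if_negative[OF assms(3) _ that] by blast
  then show ?thesis by (metis mem_Collect_eq not_le subsetI)
qed

end
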